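(* Let $M\ge 1$ be an integer, $N=2M+1$, and let $\rho>0$ be a constant (the boundary is the circle of radius $\rho$). For $R_0>0$ let $S=S(R_0)\in\mathbb R^{N\times(2M+1)}$ be the (square) modified Trefftz collocation matrix with parameters $M,\rho,R_0$. Then the optimal characteristic length, i.e. the value $R_0^{\rm opt}$ of $R_0>0$ that minimizes $\operatorname{cond}_2(S(R_0))$, is given by $$R_0^{\rm opt}=2^{1/(2M)}\rho,$$ and the minimal condition number is $$\operatorname{cond}_2\bigl(S(R_0^{\rm opt})\bigr)=2^{(M-1)/(2M)}.$$
   Context: Put $\theta_j=2\pi(j-1)/N$ for $j=1,\dots,N$. The modified Trefftz collocation matrix $S$ for the circular boundary of radius $\rho$ with characteristic length $R_0$ has entries $$S_{j,1}=1,\quad S_{j,2k}=\left(\frac{R_0}{\rho}\right)^k\cos k\theta_j,\quad S_{j,2k+1}=\left(\frac{R_0}{\rho}\right)^k\sin k\theta_j\qquad(j=1,\dots,N;\ k=1,\dots,M).$$ For an invertible matrix $Q$, $\operatorname{cond}_2(Q)=\|Q\|_2\|Q^{-1}\|_2$, where $\|Q\|_2$ is the largest singular value of $Q$. *)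

theory Defs
  imports
    Complex_Main
    "Jordan_Normal_Form.Gauss_Jordan_Elimination"
    "Jordan_Normal_Form.Spectral_Radius"
begin

definition collocation_angle :: "nat \<Rightarrow> nat \<Rightarrow> real" where
  "collocation_angle N j = 2 * pi * (real j - 1) / real N"

text \<open>
  Row index \<open>j = 1, \<dots>, N\<close> and column index \<open>l = 1, \<dots>, 2 * M + 1\<close> are both counted from 1.
  For \<open>l = 2 * k\<close> and for \<open>l = 2 * k + 1\<close> alike, \<open>l div 2 = k\<close>.
\<close>
definition trefftz_entry :: "nat \<Rightarrow> real \<Rightarrow> real \<Rightarrow> nat \<Rightarrow> nat \<Rightarrow> real" where
  "trefftz_entry N \<rho> R0 j l =
    (if l = 1 then 1
     else if even l then (R0 / \<rho>) ^ (l div 2) * cos (real (l div 2) * collocation_angle N j)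
     else (R0 / \<rho>) ^ (l div 2) * sin (real (l div 2) * collocation_angle N j))"

text \<open>Matrices of type \<open>real mat\<close> are indexed from 0, hence the shift.\<close>
definition trefftz_matrix :: "nat \<Rightarrow> nat \<Rightarrow> real \<Rightarrow> real \<Rightarrow> real mat" where
  "trefftz_matrix N M \<rho> R0 =
    mat N (2 * M + 1) (\<lambda>(r, c). trefftz_entry N \<rho> R0 (r + 1) (c + 1))"

definition singular_values :: "real mat \<Rightarrow> real set" where
  "singular_values A = sqrt ` spectrum (transpose_mat A * A)"

definition norm2_mat :: "real mat \<Rightarrow> real" where
  "norm2_mat A = Max (singular_values A)"

text \<open>Only meaningful for invertible \<open>Q\<close>, where \<open>mat_inverse Q\<close> is \<open>Some\<close> of the inverse.\<close>
definition cond2 :: "real mat \<Rightarrow> real" where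
  "cond2 Q = norm2_mat Q * norm2_mat (the (mat_inverse Q))"

end

theory Submission
  imports Defs "HOL-Library.Real_Mod"
begin

text \<open>
  The columns of \<open>S\<close> are orthogonal, because they sample trigonometric functions of order at most
  \<open>M\<close> at \<open>N > 2 * M\<close> equispaced points. With \<open>x = R0 / \<rho>\<close> the squared singular values are therefore
  the squared column norms \<open>N\<close> and \<open>N * x ^ (2 * k) / 2\<close> for \<open>1 \<le> k \<le> M\<close>, and the squared
  condition number is the largest quotient of two of them. The quotient \<open>2 / x\<^sup>2\<close> decreases in \<open>x\<close>,
  while \<open>x ^ (2 * M - 2)\<close> (or \<open>x\<^sup>2 / 2\<close> if \<open>M = 1\<close>) increases. They agree when \<open>x ^ (2 * M) = 2\<close>,
  and there no other quotient exceeds them.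
\<close>

section \<open>Trigonometric sums over equispaced points\<close>

text \<open>For \<open>m\<close> nonzero the sum is the real part of a multiple of a geometric
  series in an \<open>N\<close>-th root of unity, which differs from 1 because \<open>N\<close> does
  not divide \<open>m\<close>. The phase \<open>\<phi>\<close> lets one statement serve sines and
  cosines.\<close>

lemma sum_cos_equispaced:
  fixes m :: int and \<phi> :: real
  assumes "\<bar>m\<bar> < int N"
  shows "(\<Sum>j<N. cos (of_int m * (2 * pi * real j / real N) - \<phi>)) =
    (if m = 0 then real N * cos \<phi> else 0)"
proof (cases "m = 0")
  case False
  have N: "N > 0" using assms by linarith
  define z where "z = cis (of_int m * (2 * pi / real N))"
  have "z \<noteq> 1"
  proof
    assume "z = 1"
    then obtain n :: int where "of_int m * (2 * pi / real N) = of_int n * (2 * pi)"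
      unfolding z_def cis_eq_1_iff by blast
    then have "real_of_int m = of_int (n * int N)"
      using N by (simp add: field_simps)
    then have "m = n * int N" by (simp only: of_int_eq_iff)
    then have "int N dvd m" by simp
    with assms False show False by (meson zdvd_imp_le dvd_abs_iff zero_less_abs_iff not_le)
  qed
  moreover have "z ^ N = 1"
    using N by (simp add: z_def DeMoivre cis_eq_1_iff)
  ultimately have sum0: "(\<Sum>j<N. z ^ j) = 0" by (simp add: geometric_sum)
  have "(\<Sum>j<N. cos (of_int m * (2 * pi * real j / real N) - \<phi>)) = (\<Sum>j<N. Re (cis (- \<phi>) * z ^ j))"
    by (intro sum.cong refl) (simp add: z_def DeMoivre cis_mult algebra_simps)
  also have "\<dots> = Re (cis (- \<phi>) * (\<Sum>j<N. z ^ j))"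
    by (simp only: Re_sum sum_distrib_left)
  finally show ?thesis using False sum0 by simp
qed simp

section \<open>Condition number of a square matrix with orthogonal columns\<close>

lemma spectrum_mat_diag:
  fixes d :: "nat \<Rightarrow> 'a :: field"
  shows "spectrum (mat_diag n d) = d ` {..<n}"
proof -
  have "upper_triangular (mat_diag n d)"
    by (auto simp: mat_diag_def)
  then have "char_poly (mat_diag n d) = (\<Prod>a\<leftarrow>diag_mat (mat_diag n d). [:- a, 1:])"
    by (rule char_poly_upper_triangular[OF mat_diag_dim])
  moreover have "diag_mat (mat_diag n d) = map d [0..<n]"
    by (simp add: diag_mat_def mat_diag_def cong: map_cong)
  ultimately have "poly (char_poly (mat_diag n d)) k = (\<Prod>i\<leftarrow>[0..<n]. k - d i)" for k
    by (simp add: poly_prod_list o_def)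
  then show ?thesis
    unfolding spectrum_root_char_poly[OF mat_diag_dim]
    by (auto simp: prod_list_zero_iff)
qed

context
  fixes A :: "real mat" and n :: nat and d :: "nat \<Rightarrow> real"
  assumes A: "A \<in> carrier_mat n n"
    and gram: "transpose_mat A * A = mat_diag n d"
    and pos: "\<And>i. i < n \<Longrightarrow> d i > 0"
begin

private abbreviation "Dinv \<equiv> mat_diag n (\<lambda>i. inverse (d i))"

private lemma inverse_carrier: "Dinv * transpose_mat A \<in> carrier_mat n n"
  by (rule mult_carrier_mat[of _ n n]) (use A in auto)

private lemma left_inverse: "(Dinv * transpose_mat A) * A = 1\<^sub>m n"
proof -
  have "(Dinv * transpose_mat A) * A = Dinv * mat_diag n d"
    using A by (subst assoc_mult_mat[of _ n n _ n _ n]) (auto simp: gram)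
  also have "\<dots> = 1\<^sub>m n"
    unfolding mat_diag_diag
    using pos by (auto simp: mat_diag_def less_imp_neq[symmetric] intro!: eq_matI)
  finally show ?thesis .
qed

private lemma right_inverse: "A * (Dinv * transpose_mat A) = 1\<^sub>m n"
  by (rule mat_mult_left_right_inverse[OF inverse_carrier A left_inverse])

lemma invertible_mat_orthogonal_columns: "invertible_mat A"
  unfolding invertible_mat_def inverts_mat_def
  using left_inverse right_inverse inverse_carrier A by (auto intro!: exI[of _ "Dinv * transpose_mat A"])

text \<open>\<open>mat_inverse\<close> cannot fail, since the explicit inverse makes
  \<open>A\<close> a unit of the matrix ring; what it returns is then fixed by uniqueness of
  inverses.\<close>

private lemma mat_inverse_eq: "mat_inverse A = Some (Dinv * transpose_mat A)"
proof (cases "mat_inverse A")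
  case None
  have "A \<in> Units (ring_mat TYPE(real) n ())"
    using left_inverse right_inverse inverse_carrier A
    unfolding Units_def ring_mat_def
    by (auto intro!: bexI[of _ "Dinv * transpose_mat A"])
  with mat_inverse(1)[OF A None, of "()"] show ?thesis by blast
next
  case (Some C)
  note C = mat_inverse(2)[OF A Some]
  have "C = C * (A * (Dinv * transpose_mat A))"
    using C right_mult_one_mat[of C n n] by (simp only: right_inverse)
  also have "\<dots> = (C * A) * (Dinv * transpose_mat A)"
    using C by (intro assoc_mult_mat[OF _ A inverse_carrier, of _ n, symmetric]) simp
  also have "\<dots> = Dinv * transpose_mat A" using C left_mult_one_mat[OF inverse_carrier] by simp
  finally show ?thesis using Some by simp
qed

text \<open>The inverse \<open>B\<close> of \<open>A\<close> satisfies \<open>transpose_mat B * B = A * Dinv * B\<close>, which is similar to \<open>Dinv\<close>.\<close>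
private lemma spectrum_gram_inverse:
  "spectrum (transpose_mat (Dinv * transpose_mat A) * (Dinv * transpose_mat A)) =
    (\<lambda>i. inverse (d i)) ` {..<n}"
proof -
  let ?B = "Dinv * transpose_mat A"
  have "transpose_mat Dinv = Dinv"
    by (auto simp: mat_diag_def intro!: eq_matI)
  then have tB: "transpose_mat ?B = A * Dinv"
    using A by (subst transpose_mult[of _ n n _ n]) auto
  have "similar_mat (transpose_mat ?B * ?B) Dinv"
    unfolding tB
    by (rule similar_matI[of _ _ A ?B n]) (use A inverse_carrier left_inverse right_inverse in auto)
  then have "char_poly (transpose_mat ?B * ?B) = char_poly Dinv"
    by (rule char_poly_similar)
  moreover have "transpose_mat ?B * ?B \<in> carrier_mat n n" using A by auto
  ultimately have "spectrum (transpose_mat ?B * ?B) = spectrum Dinv"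
    by (simp add: spectrum_root_char_poly[of _ n])
  then show ?thesis by (simp add: spectrum_mat_diag)
qed

lemma cond2_orthogonal_columns:
  "cond2 A = Max ((\<lambda>i. sqrt (d i)) ` {..<n}) * Max ((\<lambda>i. sqrt (inverse (d i))) ` {..<n})"
  by (simp add: cond2_def norm2_mat_def singular_values_def mat_inverse_eq
      spectrum_gram_inverse gram spectrum_mat_diag image_image)

text \<open>Together with the next lemma this avoids locating the two maxima: a single pair of
  columns bounds \<open>cond2 A\<close> from below, and a bound on all pairs bounds it from
  above.\<close>

lemma cond2_orthogonal_columns_ge:
  assumes "i < n" "j < n"
  shows "sqrt (d i / d j) \<le> cond2 A"
proof -
  have "sqrt (d i / d j) = sqrt (d i) * sqrt (inverse (d j))"
    by (simp add: divide_inverse real_sqrt_mult)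
  also have "\<dots> \<le> cond2 A"
    unfolding cond2_orthogonal_columns
    using assms pos[of i] pos[of j]
    \<comment> \<open>The \<open>order.trans\<close> rule serves the side condition that the first
      maximum is nonnegative, through its member \<open>sqrt (d i)\<close>.\<close>
    by (intro mult_mono Max_ge order.trans[OF _ Max_ge[of _ "sqrt (d i)"]]) auto
  finally show ?thesis .
qed

lemma cond2_orthogonal_columns_le:
  assumes "n > 0" and "\<And>i j. i < n \<Longrightarrow> j < n \<Longrightarrow> sqrt (d i / d j) \<le> c"
  shows "cond2 A \<le> c"
proof -
  have ne: "{..<n} \<noteq> {}" using assms(1) by auto
  have "Max ((\<lambda>i. sqrt (d i)) ` {..<n}) \<in> (\<lambda>i. sqrt (d i)) ` {..<n}"
    using ne by (intro Max_in) auto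
  moreover have "Max ((\<lambda>i. sqrt (inverse (d i))) ` {..<n}) \<in> (\<lambda>i. sqrt (inverse (d i))) ` {..<n}"
    using ne by (intro Max_in) auto
  ultimately obtain i j where "i < n" "j < n" "cond2 A = sqrt (d i) * sqrt (inverse (d j))"
    unfolding cond2_orthogonal_columns by auto
  then show ?thesis
    using assms(2)[of i j] by (simp add: divide_inverse real_sqrt_mult)
qed

end

section \<open>Gram matrix of the Trefftz matrix\<close>

text \<open>Squared norm of column \<open>c\<close>, counted from 0, with \<open>x = R0 / \<rho>\<close>.\<close>
definition trefftz_col_sq :: "nat \<Rightarrow> real \<Rightarrow> nat \<Rightarrow> real" where
  "trefftz_col_sq N x c = (if c = 0 then real N else real N / 2 * x ^ (2 * ((c + 1) div 2)))"

text \<open>Writing sines as shifted cosines treats all pairs of columns alike.\<close>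
lemma trefftz_entry_cos:
  "trefftz_entry N \<rho> R0 (r + 1) (c + 1) =
    (R0 / \<rho>) ^ ((c + 1) div 2) *
    cos (real ((c + 1) div 2) * (2 * pi * real r / real N) - (if c = 0 \<or> odd c then 0 else pi / 2))"
  by (auto simp: trefftz_entry_def collocation_angle_def cos_diff)

lemma trefftz_gram:
  assumes N: "N = 2 * M + 1"
  shows "transpose_mat (trefftz_matrix N M \<rho> R0) * trefftz_matrix N M \<rho> R0 =
    mat_diag N (trefftz_col_sq N (R0 / \<rho>))"
proof (rule eq_matI)
  fix a b
  assume "a < dim_row (mat_diag N (trefftz_col_sq N (R0 / \<rho>)))"
    and "b < dim_col (mat_diag N (trefftz_col_sq N (R0 / \<rho>)))"
  then have ab: "a < N" "b < N" by (auto simp: mat_diag_def)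
  define k l where "k = (a + 1) div 2" and "l = (b + 1) div 2"
  define \<phi> where "\<phi> c = (if c = 0 \<or> odd c then 0 else pi / 2)" for c :: nat
  define \<theta> where "\<theta> j = 2 * pi * real j / real N" for j
  have "k \<le> M" "l \<le> M"
    using ab N by (auto simp: k_def l_def)
  \<comment> \<open>Both frequencies from the product-to-sum formula stay below
    \<open>N = 2 * M + 1\<close>, so no aliasing occurs and only frequency 0 contributes.\<close>
  then have kl: "\<bar>int k - int l\<bar> < int N" "\<bar>int k + int l\<bar> < int N"
    using N by linarith+
  have "(transpose_mat (trefftz_matrix N M \<rho> R0) * trefftz_matrix N M \<rho> R0) $$ (a, b) =
      (\<Sum>j<N. trefftz_entry N \<rho> R0 (j + 1) (a + 1) * trefftz_entry N \<rho> R0 (j + 1) (b + 1))"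
    using ab N by (simp add: trefftz_matrix_def scalar_prod_def lessThan_atLeast0)
  also have "\<dots> = (\<Sum>j<N. (R0 / \<rho>) ^ (k + l) / 2 *
      (cos (of_int (int k - int l) * \<theta> j - (\<phi> a - \<phi> b)) +
       cos (of_int (int k + int l) * \<theta> j - (\<phi> a + \<phi> b))))"
  proof (intro sum.cong refl)
    fix j
    have "cos (real k * \<theta> j - \<phi> a) * cos (real l * \<theta> j - \<phi> b) =
        (cos (of_int (int k - int l) * \<theta> j - (\<phi> a - \<phi> b)) +
         cos (of_int (int k + int l) * \<theta> j - (\<phi> a + \<phi> b))) / 2"
      unfolding cos_times_cos by (simp add: algebra_simps)
    then show "trefftz_entry N \<rho> R0 (j + 1) (a + 1) * trefftz_entry N \<rho> R0 (j + 1) (b + 1) =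
        (R0 / \<rho>) ^ (k + l) / 2 *
        (cos (of_int (int k - int l) * \<theta> j - (\<phi> a - \<phi> b)) +
         cos (of_int (int k + int l) * \<theta> j - (\<phi> a + \<phi> b)))"
      unfolding trefftz_entry_cos k_def[symmetric] l_def[symmetric] \<phi>_def[symmetric] \<theta>_def[symmetric]
      by (simp add: power_add)
  qed
  also have "\<dots> = (R0 / \<rho>) ^ (k + l) / 2 *
      ((if int k - int l = 0 then real N * cos (\<phi> a - \<phi> b) else 0) +
       (if int k + int l = 0 then real N * cos (\<phi> a + \<phi> b) else 0))"
    unfolding sum_distrib_left[symmetric] sum.distrib \<theta>_def
      sum_cos_equispaced[OF kl(1)] sum_cos_equispaced[OF kl(2)] ..
  also have "\<dots> = (if a = b then trefftz_col_sq N (R0 / \<rho>) b else 0)"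
  proof (cases "a = b")
    case True
    then have "k = l" by (simp add: k_def l_def)
    show ?thesis
    \<comment> \<open>For the constant column both frequencies vanish and give \<open>N\<close>; for
      any other column only the difference does, giving the factor \<open>N / 2\<close>.\<close>
    proof (cases "b = 0")
      case False
      then have "l \<noteq> 0" by (simp add: l_def)
      have "trefftz_col_sq N (R0 / \<rho>) b = real N / 2 * (R0 / \<rho>) ^ (l + l)"
        using False unfolding trefftz_col_sq_def l_def by (simp only: mult_2 if_False)
      then show ?thesis using \<open>l \<noteq> 0\<close> \<open>k = l\<close> True by simp
    qed (use True in \<open>simp add: trefftz_col_sq_def k_def l_def \<phi>_def\<close>)
  next
    case False
    \<comment> \<open>Distinct columns of equal order are a cosine and a sine, with phases
      \<open>pi / 2\<close> apart.\<close>
    have "cos (\<phi> a - \<phi> b) = 0" if "k = l"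
    proof -
      have "(a = 0 \<or> odd a) \<noteq> (b = 0 \<or> odd b)"
        using that False unfolding k_def l_def by presburger
      then show ?thesis by (auto simp: \<phi>_def)
    qed
    moreover have "int k + int l \<noteq> 0"
      using False by (auto simp: k_def l_def)
    ultimately show ?thesis using False by auto
  qed
  finally show "(transpose_mat (trefftz_matrix N M \<rho> R0) * trefftz_matrix N M \<rho> R0) $$ (a, b) =
      mat_diag N (trefftz_col_sq N (R0 / \<rho>)) $$ (a, b)"
    using ab by (simp add: mat_diag_def)
qed (use N in \<open>auto simp: trefftz_matrix_def mat_diag_def\<close>)

section \<open>Optimal characteristic length\<close>

theorem corollary1:
  fixes M N :: nat and \<rho> :: real
  assumes "M \<ge> 1" and "N = 2 * M + 1" and "\<rho> > 0"
  shows "(\<forall>R0>0. invertible_mat (trefftz_matrix N M \<rho> R0)) \<and>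
    (\<forall>R0. is_arg_min (\<lambda>R. cond2 (trefftz_matrix N M \<rho> R)) (\<lambda>R. R > 0) R0
            \<longleftrightarrow> R0 = 2 powr (1 / (2 * real M)) * \<rho>) \<and>
    cond2 (trefftz_matrix N M \<rho> (2 powr (1 / (2 * real M)) * \<rho>))
      = 2 powr ((real M - 1) / (2 * real M))"
proof -
  have N: "N > 0" using assms by simp
  define S where "S = trefftz_matrix N M \<rho>"
  define d where "d = trefftz_col_sq N"
  define x0 :: real where "x0 = 2 powr (1 / (2 * real M))"
  have S: "S R \<in> carrier_mat N N" for R
    using assms by (simp add: S_def trefftz_matrix_def)
  have gram: "transpose_mat (S R) * S R = mat_diag N (d (R / \<rho>))" for R
    unfolding S_def d_def using assms(2) by (rule trefftz_gram)
  have dpos: "d x i > 0" if "x > 0" for x i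
    using that N by (simp add: d_def trefftz_col_sq_def)
  have rpos: "R / \<rho> > 0" if "R > 0" for R using that assms(3) by simp
  note ge = cond2_orthogonal_columns_ge[OF S gram dpos[OF rpos]]
  have d_simps: "d x 0 = N" "d x 1 = N / 2 * x\<^sup>2" "d x (2 * M) = N / 2 * x ^ (2 * M)" for x
    using assms(1) by (simp_all add: d_def trefftz_col_sq_def)
  have x0_gt1: "x0 > 1" using assms(1) by (simp add: x0_def)
  have x0_pow: "x0 ^ (2 * M) = 2"
    using assms(1) by (simp add: x0_def powr_powr flip: powr_realpow)
  have x0_sq: "x0\<^sup>2 \<le> 2"
    using power_increasing[of 2 "2 * M" x0] x0_gt1 assms(1) x0_pow by simp
  have opt_value: "2 powr ((real M - 1) / (2 * real M)) = sqrt (2 / x0\<^sup>2)"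
  proof -
    have "(real M - 1) / (2 * real M) = 1 / 2 - 1 / (2 * real M)"
      using assms(1) by (simp add: field_simps)
    then show ?thesis
      using x0_gt1 by (simp add: powr_diff powr_half_sqrt real_sqrt_divide x0_def)
  qed
  have opt_le: "cond2 (S (x0 * \<rho>)) \<le> sqrt (2 / x0\<^sup>2)"
  proof (rule cond2_orthogonal_columns_le[OF S gram dpos[OF rpos] N])
    fix i j assume ij: "i < N" "j < N"
    \<comment> \<open>At \<open>x0\<close> the constant column ties with those of order
      \<open>M\<close> for the largest norm, and the columns of order 1 have the smallest.\<close>
    have "d x0 i \<le> N"
    proof (cases "i = 0")
      case False
      have "x0 ^ (2 * ((i + 1) div 2)) \<le> x0 ^ (2 * M)"
        using ij x0_gt1 assms(2) by (intro power_increasing) auto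
      then show ?thesis using N x0_pow False by (simp add: d_def trefftz_col_sq_def)
    qed (simp add: d_simps)
    moreover have "N / 2 * x0\<^sup>2 \<le> d x0 j"
    proof (cases "j = 0")
      case False
      have "x0\<^sup>2 \<le> x0 ^ (2 * ((j + 1) div 2))"
        using False x0_gt1 by (intro power_increasing) auto
      then show ?thesis using N False by (simp add: d_def trefftz_col_sq_def)
    qed (use N x0_sq in \<open>simp add: d_simps\<close>)
    ultimately have "d x0 i / d x0 j \<le> N / (N / 2 * x0\<^sup>2)"
      using N x0_gt1 by (intro frac_le) auto
    also have "\<dots> = 2 / x0\<^sup>2" using N by simp
    finally show "sqrt (d (x0 * \<rho> / \<rho>) i / d (x0 * \<rho> / \<rho>) j) \<le> sqrt (2 / x0\<^sup>2)"
      using assms(3) by simp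
  qed (use x0_gt1 assms(3) in auto)
  have other_gt: "sqrt (2 / x0\<^sup>2) < cond2 (S R)" if "R > 0" "R \<noteq> x0 * \<rho>" for R
  proof -
    define x where "x = R / \<rho>"
    have x: "x > 0" "x \<noteq> x0" using that assms(3) by (auto simp: x_def)
    have gt: ?thesis if "i < N" "j < N" "2 / x0\<^sup>2 < d x i / d x j" for i j
    proof -
      have "sqrt (2 / x0\<^sup>2) < sqrt (d x i / d x j)" using that by simp
      also have "\<dots> \<le> cond2 (S R)" unfolding x_def using that \<open>R > 0\<close> by (intro ge) auto
      finally show ?thesis .
    qed
    \<comment> \<open>For \<open>M = 1\<close> the columns \<open>2 * M\<close> and \<open>1\<close>
      have the same order and their quotient is constantly 1, so beyond \<open>x0\<close> the
      constant column must serve as the denominator.\<close>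
    consider "x < x0" | "x > x0" "M = 1" | "x > x0" "M \<ge> 2"
      using x assms(1) by linarith
    then show ?thesis
    proof cases
      case 1
      then have "x\<^sup>2 < x0\<^sup>2" using x by (intro power_strict_mono) auto
      then have "2 / x0\<^sup>2 < 2 / x\<^sup>2"
        using x x0_gt1 by (intro divide_strict_left_mono) auto
      also have "\<dots> = d x 0 / d x 1"
        using N unfolding d_simps by simp
      finally have "2 / x0\<^sup>2 < d x 0 / d x 1" .
      then show ?thesis using assms by (intro gt[of 0 1]) auto
    next
      case 2
      then have "x0\<^sup>2 < x\<^sup>2" using x0_gt1 by (intro power_strict_mono) auto
      moreover have "x0\<^sup>2 = 2" using x0_pow 2 by simp
      ultimately have "2 / x0\<^sup>2 < d x 1 / d x 0"
        using N unfolding d_simps by (simp add: field_simps)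
      then show ?thesis using assms by (intro gt[of 1 0]) auto
    next
      case 3
      then have "x0 ^ (2 * M - 2) < x ^ (2 * M - 2)"
        using x0_gt1 by (intro power_strict_mono) auto
      moreover have "2 / x0\<^sup>2 = x0 ^ (2 * M - 2)"
        using x0_pow x0_gt1 3 by (simp add: power_diff)
      moreover have "d x (2 * M) / d x 1 = x ^ (2 * M - 2)"
        using x N 3 unfolding d_simps by (simp add: power_diff)
      ultimately show ?thesis using assms by (intro gt[of "2 * M" 1]) auto
    qed
  qed
  have opt: "cond2 (S (x0 * \<rho>)) = sqrt (2 / x0\<^sup>2)"
  proof (rule antisym[OF opt_le])
    have "d x0 0 / d x0 1 = 2 / x0\<^sup>2" using N unfolding d_simps by simp
    then show "sqrt (2 / x0\<^sup>2) \<le> cond2 (S (x0 * \<rho>))"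
      using ge[of "x0 * \<rho>" 0 1] x0_gt1 assms by simp
  qed
  have "\<forall>R>0. invertible_mat (S R)"
    using invertible_mat_orthogonal_columns[OF S gram dpos[OF rpos]] by blast
  moreover have "is_arg_min (\<lambda>R. cond2 (S R)) (\<lambda>R. R > 0) R0 \<longleftrightarrow> R0 = x0 * \<rho>" for R0
  proof -
    have "x0 * \<rho> > 0" using x0_gt1 assms(3) by simp
    then show ?thesis
      \<comment> \<open>The strict inequality away from \<open>x0 * \<rho>\<close> yields both
        minimality there and uniqueness of the minimizer.\<close>
      using other_gt opt unfolding is_arg_min_def by (metis order.asym order.irrefl)
  qed
  ultimately show ?thesis
    using opt[folded opt_value] unfolding S_def x0_def by blast
qed

end
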